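(* For every $n\ge0$, the function $h_{n+1}$ on the permutation group $S(n+1)$ is of the form $$h_{n+1}=\sum_{k=1}^{n+1}s_{k-1}\cdot\tilde{s}_{(n+1)-k},$$ where $s_{k-1}\cdot\tilde{s}_{(n+1)-k}$ denotes the characteristic function of the subgroup $S(k-1)\times\tilde S(n+1-k)$ of $S(n+1)$; and $h_{n+1}$ is positive definite on $S(n+1)$.
   Context: $S(m)$ is the group of permutations of $\{1,\dots,m\}$. For $\sigma\in S(m)$ let $j(\sigma)=\{(k,\,2m+1-\sigma(k)):k=1,\dots,m\}$, a pair-partition of $\{1,\dots,2m\}$ (a partition into blocks of size two, written $(i,j)$ with $i<j$). Two blocks $(i_1,j_1),(i_2,j_2)$ cross if $i_1<i_2<j_1<j_2$ or $i_2<i_1<j_2<j_1$. A block is a singleton if it crosses no other block, and $h_m(\sigma)$ is the number of singletons of $j(\sigma)$. For $1\le k\le n+1$, $S(k-1)\times\tilde S(n+1-k)\subset S(n+1)$ is the subgroup of permutations that fix $k$ and map $\{1,\dots,k-1\}$ onto itself and $\{k+1,\dots,n+1\}$ onto itself ($S(k-1)$ acting on the letters $1,\dots,k-1$ and $\tilde S(n+1-k)$ on the letters $k+1,\dots,n+1$). A function $\varphi$ on a group $\Gamma$ is positive definite if $\sum_{i,l}\varphi(g_i^{-1}g_l)\overline{z_i}z_l\ge0$ for all finite families $g_i\in\Gamma$, $z_i\in\mathbb{C}$. *)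

theory Defs
  imports "HOL-Algebra.Sym_Groups" "HOL-Library.Complex_Order" "HOL-Library.Indicator_Function"
begin

text \<open>A pair-partition is represented by the set of its blocks, a block being the ordered pair
  \<open>(i, j)\<close> of its elements with \<open>i < j\<close>.\<close>

definition perm_pairing :: "nat \<Rightarrow> (nat \<Rightarrow> nat) \<Rightarrow> (nat \<times> nat) set" where
  "perm_pairing m \<sigma> = (\<lambda>k. (k, 2 * m + 1 - \<sigma> k)) ` {1..m}"

lemma perm_pairing_less:
  assumes "\<sigma> \<in> carrier (sym_group m)" and "(i, j) \<in> perm_pairing m \<sigma>"
  shows "i < j"
proof -
  have "\<sigma> k \<le> m" if "k \<in> {1..m}" for k
    using that assms(1) permutes_in_image[of \<sigma> "{1..m}" k] by (auto simp: sym_group_def)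
  moreover from assms(2) obtain k where "k \<in> {1..m}" "i = k" "j = 2 * m + 1 - \<sigma> k"
    unfolding perm_pairing_def by blast
  ultimately show ?thesis by fastforce
qed

lemma perm_pairing_is_pair_partition:
  assumes "\<sigma> \<in> carrier (sym_group m)"
  shows "partition_on {1..2 * m} ((\<lambda>(i, j). {i, j}) ` perm_pairing m \<sigma>)"
proof -
  have p: "\<sigma> permutes {1..m}" using assms by (simp add: sym_group_def)
  have b: "1 \<le> \<sigma> k" "\<sigma> k \<le> m" if "k \<in> {1..m}" for k
    using that p permutes_in_image[of \<sigma> "{1..m}" k] by auto
  have i: "\<sigma> k = \<sigma> l \<longleftrightarrow> k = l" for k l
    using permutes_inj[OF p] by (auto simp: inj_def)
  have eq: "(\<lambda>(i, j). {i, j}) ` perm_pairing m \<sigma> = (\<lambda>k. {k, 2 * m + 1 - \<sigma> k}) ` {1..m}"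
    by (simp add: perm_pairing_def image_image)
  have cover: "x \<in> \<Union> ((\<lambda>k. {k, 2 * m + 1 - \<sigma> k}) ` {1..m})" if x: "x \<in> {1..2 * m}" for x
  proof (cases "x \<le> m")
    case True
    then show ?thesis using x by auto
  next
    case False
    then have "2 * m + 1 - x \<in> {1..m}" using x by auto
    then obtain k where k: "k \<in> {1..m}" "\<sigma> k = 2 * m + 1 - x"
      using permutes_image[OF p] by (metis imageE)
    then have "x = 2 * m + 1 - \<sigma> k" using x by auto
    then show ?thesis using k(1) by blast
  qed
  have "\<Union> ((\<lambda>k. {k, 2 * m + 1 - \<sigma> k}) ` {1..m}) = {1..2 * m}"
  proof
    show "\<Union> ((\<lambda>k. {k, 2 * m + 1 - \<sigma> k}) ` {1..m}) \<subseteq> {1..2 * m}"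
    proof (intro UN_least)
      fix k assume "k \<in> {1..m}"
      then show "{k, 2 * m + 1 - \<sigma> k} \<subseteq> {1..2 * m}"
        using b[of k] by auto
    qed
  qed (use cover in blast)
  moreover have "disjoint ((\<lambda>k. {k, 2 * m + 1 - \<sigma> k}) ` {1..m})"
    unfolding disjoint_def
  proof (intro ballI impI)
    fix A B
    assume A: "A \<in> (\<lambda>k. {k, 2 * m + 1 - \<sigma> k}) ` {1..m}"
      and B: "B \<in> (\<lambda>k. {k, 2 * m + 1 - \<sigma> k}) ` {1..m}" and "A \<noteq> B"
    obtain k where k: "k \<in> {1..m}" "A = {k, 2 * m + 1 - \<sigma> k}" using A by (rule imageE)
    obtain l where l: "l \<in> {1..m}" "B = {l, 2 * m + 1 - \<sigma> l}" using B by (rule imageE)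
    have kl: "k \<noteq> l" using \<open>A \<noteq> B\<close> k(2) l(2) by metis
    have "\<sigma> k \<noteq> \<sigma> l" using i kl by simp
    then show "A \<inter> B = {}"
      unfolding k(2) l(2) using kl k(1) l(1) b[OF k(1)] b[OF l(1)] by auto
  qed
  moreover have "{} \<notin> (\<lambda>k. {k, 2 * m + 1 - \<sigma> k}) ` {1..m}"
    by (simp add: image_iff)
  ultimately show ?thesis
    unfolding eq partition_on_def by (intro conjI)
qed

definition crosses :: "nat \<times> nat \<Rightarrow> nat \<times> nat \<Rightarrow> bool" where
  "crosses = (\<lambda>(i1, j1) (i2, j2). (i1 < i2 \<and> i2 < j1 \<and> j1 < j2) \<or> (i2 < i1 \<and> i1 < j2 \<and> j2 < j1))"

definition singleton_blocks :: "(nat \<times> nat) set \<Rightarrow> (nat \<times> nat) set" where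
  "singleton_blocks P = {b \<in> P. \<forall>c \<in> P. c \<noteq> b \<longrightarrow> \<not> crosses b c}"

definition num_singletons :: "nat \<Rightarrow> (nat \<Rightarrow> nat) \<Rightarrow> nat" where
  "num_singletons m \<sigma> = card (singleton_blocks (perm_pairing m \<sigma>))"

definition split_subgroup :: "nat \<Rightarrow> nat \<Rightarrow> (nat \<Rightarrow> nat) set" where
  "split_subgroup m k = {\<sigma> \<in> carrier (sym_group m).
     \<sigma> k = k \<and> \<sigma> ` {1..<k} = {1..<k} \<and> \<sigma> ` {k<..m} = {k<..m}}"

lemma subgroup_split_subgroup: "subgroup (split_subgroup m k) (sym_group m)"
proof -
  interpret group "sym_group m" by (rule sym_group_is_group)
  show ?thesis
  proof (rule subgroupI)
    show "split_subgroup m k \<subseteq> carrier (sym_group m)"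
      by (auto simp: split_subgroup_def)
    have "id \<in> split_subgroup m k"
      by (simp add: split_subgroup_def sym_group_def permutes_id)
    then show "split_subgroup m k \<noteq> {}" by blast
  next
    fix \<sigma> assume s: "\<sigma> \<in> split_subgroup m k"
    then have c: "\<sigma> \<in> carrier (sym_group m)" and p: "\<sigma> permutes {1..m}"
      by (auto simp: split_subgroup_def sym_group_def)
    have im: "inv' \<sigma> ` A = A" if "\<sigma> ` A = A" for A
      using image_inv_f_f[OF permutes_inj[OF p], of A] that by simp
    have "inv' \<sigma> k = k"
      using s permutes_inverses(2)[OF p, of k] by (simp add: split_subgroup_def)
    then show "inv\<^bsub>sym_group m\<^esub> \<sigma> \<in> split_subgroup m k"
      using s c im inv_closed[OF c] by (simp add: split_subgroup_def)
  next
    fix \<sigma> \<tau> assume st: "\<sigma> \<in> split_subgroup m k" "\<tau> \<in> split_subgroup m k"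
    then have "\<sigma> \<otimes>\<^bsub>sym_group m\<^esub> \<tau> \<in> carrier (sym_group m)"
      by (intro m_closed) (auto simp: split_subgroup_def)
    moreover have "(\<sigma> \<circ> \<tau>) ` A = A" if "\<sigma> ` A = A" "\<tau> ` A = A" for A
      using that by (simp only: image_comp[symmetric])
    ultimately show "\<sigma> \<otimes>\<^bsub>sym_group m\<^esub> \<tau> \<in> split_subgroup m k"
      using st by (simp add: split_subgroup_def sym_group_mult)
  qed
qed

text \<open>In \<open>Complex_Order\<close>, \<open>0 \<le> w\<close> for complex \<open>w\<close> means that \<open>w\<close> is real and nonnegative.\<close>

definition positive_definite_on :: "('a, 'b) monoid_scheme \<Rightarrow> ('a \<Rightarrow> complex) \<Rightarrow> bool" where
  "positive_definite_on G \<phi> \<longleftrightarrow>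
     (\<forall>(N::nat) (g :: nat \<Rightarrow> 'a) (z :: nat \<Rightarrow> complex). (\<forall>i<N. g i \<in> carrier G) \<longrightarrow>
        0 \<le> (\<Sum>i<N. \<Sum>l<N. \<phi> (inv\<^bsub>G\<^esub> (g i) \<otimes>\<^bsub>G\<^esub> g l) * cnj (z i) * z l))"

end

theory Submission
  imports Defs "HOL-Algebra.Left_Coset"
begin

text \<open>The blocks with left ends \<open>k < l\<close> cross iff \<open>(k, l)\<close> is an inversion of \<open>\<sigma>\<close>. Hence \<open>k\<close> gives a
  singleton iff it is involved in no inversion; then \<open>\<sigma>\<close> maps \<open>{1..<k}\<close> into \<open>{1..<\<sigma> k}\<close> and
  \<open>{k<..m}\<close> into \<open>{\<sigma> k<..m}\<close>, and counting forces \<open>\<sigma> k = k\<close>. The characteristic function of a subgroup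
  \<open>H\<close> is positive definite because its quadratic form is the sum over the left cosets of \<open>H\<close> of
  \<open>\<bar>\<Sum>z\<^sub>i\<bar>\<^sup>2\<close>, with \<open>i\<close> ranging over the \<open>g\<^sub>i\<close> in the coset.\<close>

lemma split_if_no_inversions:
  fixes \<sigma> :: "nat \<Rightarrow> nat"
  assumes p: "\<sigma> permutes {1..m}" and k: "k \<in> {1..m}"
    and below: "\<And>l. l \<in> {1..<k} \<Longrightarrow> \<sigma> l < \<sigma> k"
    and above: "\<And>l. l \<in> {k<..m} \<Longrightarrow> \<sigma> k < \<sigma> l"
  shows "\<sigma> k = k" and "\<sigma> ` {1..<k} = {1..<k}" and "\<sigma> ` {k<..m} = {k<..m}"
proof -
  have range: "1 \<le> \<sigma> l \<and> \<sigma> l \<le> m" if "l \<in> {1..m}" for l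
    using permutes_in_image[OF p, of l] that by auto
  have inj: "inj_on \<sigma> A" for A
    using permutes_inj[OF p] by (rule inj_on_subset) simp
  have sub1: "\<sigma> ` {1..<k} \<subseteq> {1..<\<sigma> k}"
    using below range k by fastforce
  have sub2: "\<sigma> ` {k<..m} \<subseteq> {\<sigma> k<..m}"
    using above range k by fastforce
  have "k - 1 \<le> \<sigma> k - 1"
    using card_inj_on_le[OF inj sub1] by simp
  moreover have "m - k \<le> m - \<sigma> k"
    using card_inj_on_le[OF inj sub2] by simp
  \<comment> \<open>The two counts give \<open>k \<le> \<sigma> k\<close> and
    \<open>\<sigma> k \<le> k\<close>. As subtraction on \<open>nat\<close> truncates, this relies
    on \<open>1 \<le> \<sigma> k\<close> and \<open>\<sigma> k \<le> m\<close>.\<close>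
  ultimately show eq: "\<sigma> k = k"
    using range[OF k] k by auto
  show "\<sigma> ` {1..<k} = {1..<k}"
    using sub1 eq by (intro card_subset_eq) (auto simp: card_image[OF inj])
  show "\<sigma> ` {k<..m} = {k<..m}"
    using sub2 eq by (intro card_subset_eq) (auto simp: card_image[OF inj])
qed

text \<open>Every left end is at most \<open>m\<close> and every right end exceeds \<open>m\<close>,
  so the middle inequality of a crossing is automatic. The reflection in the right ends reverses the
  order of the values of \<open>\<sigma>\<close>.\<close>

lemma crosses_perm_pairing_iff:
  assumes p: "\<sigma> permutes {1..m}" and k: "k \<in> {1..m}" and l: "l \<in> {1..m}"
  shows "crosses (k, 2 * m + 1 - \<sigma> k) (l, 2 * m + 1 - \<sigma> l) \<longleftrightarrow>
    k < l \<and> \<sigma> l < \<sigma> k \<or> l < k \<and> \<sigma> k < \<sigma> l"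
proof -
  have "\<sigma> k \<in> {1..m}" "\<sigma> l \<in> {1..m}"
    using permutes_in_image[OF p] k l by blast+
  then show ?thesis
    using k l by (auto simp: crosses_def)
qed

lemma singleton_block_iff_split_subgroup:
  assumes \<sigma>: "\<sigma> \<in> carrier (sym_group m)" and k: "k \<in> {1..m}"
  shows "(k, 2 * m + 1 - \<sigma> k) \<in> singleton_blocks (perm_pairing m \<sigma>) \<longleftrightarrow> \<sigma> \<in> split_subgroup m k"
proof -
  have p: "\<sigma> permutes {1..m}" using \<sigma> by (simp add: sym_group_def)
  have "(k, 2 * m + 1 - \<sigma> k) \<in> singleton_blocks (perm_pairing m \<sigma>) \<longleftrightarrow>
      (\<forall>l\<in>{1..m}. l \<noteq> k \<longrightarrow> \<not> crosses (k, 2 * m + 1 - \<sigma> k) (l, 2 * m + 1 - \<sigma> l))"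
    using k by (auto simp: singleton_blocks_def perm_pairing_def)
  also have "\<dots> \<longleftrightarrow> (\<forall>l\<in>{1..m}. \<not> (k < l \<and> \<sigma> l < \<sigma> k \<or> l < k \<and> \<sigma> k < \<sigma> l))"
    using crosses_perm_pairing_iff[OF p k] by auto
  also have "\<dots> \<longleftrightarrow> \<sigma> \<in> split_subgroup m k"
  proof
    assume none: "\<forall>l\<in>{1..m}. \<not> (k < l \<and> \<sigma> l < \<sigma> k \<or> l < k \<and> \<sigma> k < \<sigma> l)"
    \<comment> \<open>Injectivity makes the negated inequalities strict.\<close>
    have neq: "\<sigma> l \<noteq> \<sigma> k" if "l \<noteq> k" for l
      using permutes_inj[OF p] that by (auto simp: inj_def)
    have below: "\<sigma> l < \<sigma> k" if "l \<in> {1..<k}" for l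
      using none neq[of l] that k by force
    have above: "\<sigma> k < \<sigma> l" if "l \<in> {k<..m}" for l
      using none neq[of l] that k by force
    show "\<sigma> \<in> split_subgroup m k"
      using split_if_no_inversions[OF p k below above] \<sigma> by (simp add: split_subgroup_def)
  next
    assume s: "\<sigma> \<in> split_subgroup m k"
    have "\<sigma> l < \<sigma> k" if "l \<in> {1..<k}" for l
      using s that by (auto simp: split_subgroup_def)
    moreover have "\<sigma> k < \<sigma> l" if "l \<in> {k<..m}" for l
      using s that by (auto simp: split_subgroup_def)
    ultimately show "\<forall>l\<in>{1..m}. \<not> (k < l \<and> \<sigma> l < \<sigma> k \<or> l < k \<and> \<sigma> k < \<sigma> l)"
      by (meson atLeastAtMost_iff atLeastLessThan_iff greaterThanAtMost_iff less_asym)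
  qed
  finally show ?thesis .
qed

lemma num_singletons_eq_sum_indicator:
  assumes \<sigma>: "\<sigma> \<in> carrier (sym_group m)"
  shows "num_singletons m \<sigma> = (\<Sum>k = 1..m. indicator (split_subgroup m k) \<sigma>)"
proof -
  have "singleton_blocks (perm_pairing m \<sigma>) =
      (\<lambda>k. (k, 2 * m + 1 - \<sigma> k)) ` {k \<in> {1..m}. \<sigma> \<in> split_subgroup m k}"
  proof -
    have "singleton_blocks (perm_pairing m \<sigma>) \<subseteq> (\<lambda>k. (k, 2 * m + 1 - \<sigma> k)) ` {1..m}"
      by (auto simp: perm_pairing_def singleton_blocks_def)
    then show ?thesis
      using singleton_block_iff_split_subgroup[OF \<sigma>] by blast
  qed
  \<comment> \<open>A block is determined by its left end, so counting blocks amounts to counting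
    the indices \<open>k\<close>.\<close>
  then have "num_singletons m \<sigma> = card {k \<in> {1..m}. \<sigma> \<in> split_subgroup m k}"
    by (simp add: num_singletons_def card_image inj_on_def)
  also have "\<dots> = (\<Sum>k = 1..m. indicator (split_subgroup m k) \<sigma>)"
    by (simp add: indicator_def Int_def)
  finally show ?thesis .
qed

text \<open>This turns the kernel of the quadratic form into an equivalence relation on indices:
  lying in the same left coset.\<close>

lemma (in group) inv_mult_mem_iff_l_coset_eq:
  assumes H: "subgroup H G" and x: "x \<in> carrier G" and y: "y \<in> carrier G"
  shows "inv x \<otimes> y \<in> H \<longleftrightarrow> x <# H = y <# H"
proof
  interpret subgroup H G by fact
  assume "inv x \<otimes> y \<in> H"
  then have "y \<in> x <# H"
    using lcos_module_rev[OF is_group x y] by simp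
  then show "x <# H = y <# H"
    using l_repr_independence x H by simp
next
  interpret subgroup H G by fact
  assume "x <# H = y <# H"
  moreover have "y \<in> y <# H"
    using y H by (rule lcos_self)
  ultimately show "inv x \<otimes> y \<in> H"
    using lcos_module_imp[OF is_group x] y by simp
qed

lemma (in group) positive_definite_on_subgroup_indicator:
  assumes H: "subgroup H G"
  shows "positive_definite_on G (indicator H)"
  unfolding positive_definite_on_def
proof (intro allI impI)
  fix N :: nat and g :: "nat \<Rightarrow> 'a" and z :: "nat \<Rightarrow> complex"
  assume g: "\<forall>i<N. g i \<in> carrier G"
  define f where "f i = g i <# H" for i
  define S where "S c = (\<Sum>l | l \<in> {..<N} \<and> f l = c. z l)" for c
  have "(\<Sum>i<N. \<Sum>l<N. indicator H (inv (g i) \<otimes> g l) * cnj (z i) * z l) =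
      (\<Sum>i<N. \<Sum>l<N. if f l = f i then cnj (z i) * z l else 0)"
    using g H by (intro sum.cong refl) (auto simp: inv_mult_mem_iff_l_coset_eq f_def indicator_def)
  also have "\<dots> = (\<Sum>i<N. cnj (z i) * S (f i))"
    by (simp add: S_def sum_distrib_left flip: sum.inter_filter)
  \<comment> \<open>Grouping the indices by coset makes \<open>S (f i)\<close> constant in the inner
    sum, which then factors as \<open>cnj (S c) * S c\<close>, the squared modulus of
    \<open>S c\<close>.\<close>
  also have "\<dots> = (\<Sum>c\<in>f ` {..<N}. \<Sum>i | i \<in> {..<N} \<and> f i = c. cnj (z i) * S (f i))"
    by (rule sum.image_gen) simp
  also have "\<dots> = (\<Sum>c\<in>f ` {..<N}. cnj (S c) * S c)"
    by (simp add: S_def sum_distrib_right)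
  also have "0 \<le> \<dots>"
    by (intro sum_nonneg) (simp add: less_eq_complex_def)
  finally show "0 \<le> (\<Sum>i<N. \<Sum>l<N. indicator H (inv (g i) \<otimes> g l) * cnj (z i) * z l)" .
qed

text \<open>The quadratic form is additive in the function, so exchanging sums leaves a sum of
  nonnegative forms.\<close>

lemma positive_definite_on_sum:
  fixes G :: "('a, 'b) monoid_scheme"
  assumes "\<And>k. k \<in> K \<Longrightarrow> positive_definite_on G (\<phi> k)"
  shows "positive_definite_on G (\<lambda>x. \<Sum>k\<in>K. \<phi> k x)"
  unfolding positive_definite_on_def
proof (intro allI impI)
  fix N :: nat and g :: "nat \<Rightarrow> 'a" and z :: "nat \<Rightarrow> complex"
  assume g: "\<forall>i<N. g i \<in> carrier G"
  let ?q = "\<lambda>i l. inv\<^bsub>G\<^esub> (g i) \<otimes>\<^bsub>G\<^esub> g l"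
  have "(\<Sum>i<N. \<Sum>l<N. (\<Sum>k\<in>K. \<phi> k (?q i l)) * cnj (z i) * z l) =
      (\<Sum>i<N. \<Sum>k\<in>K. \<Sum>l<N. \<phi> k (?q i l) * cnj (z i) * z l)"
    by (simp only: sum_distrib_right sum.swap[of _ K])
  also have "\<dots> = (\<Sum>k\<in>K. \<Sum>i<N. \<Sum>l<N. \<phi> k (?q i l) * cnj (z i) * z l)"
    by (rule sum.swap)
  also have "0 \<le> \<dots>"
    using assms g by (intro sum_nonneg[of K]) (simp add: positive_definite_on_def)
  finally show "0 \<le> (\<Sum>i<N. \<Sum>l<N. (\<Sum>k\<in>K. \<phi> k (?q i l)) * cnj (z i) * z l)" .
qed

text \<open>The form evaluates the function only at products of an inverse and an element of the
  group, which stay in the carrier.\<close>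

lemma (in group) positive_definite_on_cong:
  assumes "\<And>x. x \<in> carrier G \<Longrightarrow> \<phi> x = \<psi> x"
  shows "positive_definite_on G \<phi> \<longleftrightarrow> positive_definite_on G \<psi>"
  unfolding positive_definite_on_def using assms by (intro all_cong1 imp_cong refl) simp

theorem theorem5:
  fixes n :: nat
  shows "(\<forall>\<sigma> \<in> carrier (sym_group (n + 1)).
            num_singletons (n + 1) \<sigma> =
              (\<Sum>k = 1..n + 1. indicator (split_subgroup (n + 1) k) \<sigma>))
         \<and> positive_definite_on (sym_group (n + 1)) (\<lambda>\<sigma>. of_nat (num_singletons (n + 1) \<sigma>))"
proof
  interpret group "sym_group (n + 1)" by (rule sym_group_is_group)
  \<comment> \<open>The counting identity is in \<open>nat\<close>; positive definiteness needs it
    with complex-valued indicators.\<close>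
  have eq: "of_nat (num_singletons (n + 1) \<sigma>) =
      (\<Sum>k = 1..n + 1. indicator (split_subgroup (n + 1) k) \<sigma> :: complex)"
    if "\<sigma> \<in> carrier (sym_group (n + 1))" for \<sigma>
    unfolding num_singletons_eq_sum_indicator[OF that] of_nat_sum
    by (intro sum.cong refl) (simp add: indicator_def)
  have "positive_definite_on (sym_group (n + 1))
      (\<lambda>\<sigma>. \<Sum>k = 1..n + 1. indicator (split_subgroup (n + 1) k) \<sigma>)"
    by (intro positive_definite_on_sum positive_definite_on_subgroup_indicator
        subgroup_split_subgroup)
  then show
    "positive_definite_on (sym_group (n + 1)) (\<lambda>\<sigma>. of_nat (num_singletons (n + 1) \<sigma>))"
    by (rule iffD2[OF positive_definite_on_cong, rotated]) (rule eq)
qed (use num_singletons_eq_sum_indicator in blast)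

end
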